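(* Let $u\in\Omega\neq\emptyset$ with $c_u\geq\lVert x_0-u\rVert^2$ and let $M>0$ with $M\geq\lVert\xi_n\rVert$ for all $n\in\mathbb{N}$. Let $\lambda_n\in[a,b]\subseteq(0,2/M^2)$ for all $n\in\mathbb{N}$ and let $L\geq\mathrm{diam}\{x_n\mid n\in\mathbb{N}\}$ ($L\in\mathbb{R}$). Let $\varepsilon_n\geq0$ for all $n\in\mathbb{N}$ and suppose $\varepsilon_n\to0$ $(n\to\infty)$ with a nondecreasing rate of convergence $\tau:\mathbb{N}\to\mathbb{N}$. If $\psi:(0,\infty)\to\mathbb{N}$ is such that \[ \forall\varepsilon>0\ \forall x\in\overline{B_{\sqrt{c_u}}(u)}\ \left(x\in\Omega'_{\psi(\varepsilon)}\Rightarrow\mathrm{dist}(x,\Omega)<\varepsilon\right), \] then $(x_n)_{n\in\mathbb{N}}$ is convergent with $x=\lim_{n\to\infty}x_n\in\mathrm{EP}(\mathrm{Fix}(T),f)$ and \[ \forall k\in\mathbb{N}\ \forall n\geq\Phi\left(\phi\left(\frac1{2(k+1)}\right)\right)\ \left(\lVert x_n-x\rVert<\frac1{k+1}\right), \] where $\phi(\varepsilon):=\frac1{\psi(\varepsilon)+1}$ and \[ \Phi(\varepsilon):=2\left\lceil c_u\cdot(\sigma(a,b,M,L))^4\,16\left(\left\lceil\tfrac1\varepsilon\right\rceil+1\right)^4\right\rceil+\max\left\{\left\lceil\tfrac1\varepsilon\right\rceil,\tau\left(2\left\lceil\tfrac1\varepsilon\right\rceil+1\right)\right\}+1, \] \[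 \alpha(a,b,M):=-a(M^2b-2),\qquad \sigma(a,b,M,L):=\left\lceil\frac{\sqrt{2MbL}}{\sqrt[4]{\alpha(a,b,M)}}+\frac{Mb+1}{\sqrt{\alpha(a,b,M)}}+1\right\rceil. \]
   Context: Notation: $\mathbb{N}=\{0,1,2,\dots\}$. $\mathbb{R}^N$ ($N\geq1$) carries the Euclidean inner product and norm; $\overline{B_r(x)}$ is the closed ball (for $r=0$ it is $\{x\}$). Setting: $f:\mathbb{R}^N\times\mathbb{R}^N\to\mathbb{R}$ satisfies: $f(x,x)=0$ for all $x$; $f(\cdot,y)$ is continuous for every $y$; $f(x,\cdot)$ is convex for every $x$. $T:\mathbb{R}^N\to\mathbb{R}^N$ is firmly nonexpansive, i.e. $\lVert Tx-Ty\rVert^2\leq\langle x-y,Tx-Ty\rangle$ for all $x,y$, with nonempty fixed point set $\mathrm{Fix}(T)$. $\mathrm{EP}(\mathrm{Fix}(T),f):=\{u\in\mathrm{Fix}(T)\mid f(u,y)\geq0\text{ for all }y\in\mathrm{Fix}(T)\}$. The sequences are generated by the following algorithm: $x_0\in\mathbb{R}^N$ is arbitrary, $\rho_0:=\lVert x_0\rVert$. Given $x_n$ and $\rho_n$, choose $\varepsilon_n\geq0$ and $\lambda_n>0$; take $y_n\in K_n:=\overline{B_{\rho_n+1}(0)}$ with $f(y_n,x_n)\geq0$ and $\max_{y\in K_n}f(y,x_n)\leq f(y_n,x_n)+\varepsilon_n$; choose any $\xi_n\in\partial f(y_n,\cdot)(x_n)$ (subdifferential of the convex function $f(y_n,\cdot)$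 at $x_n$); set $x_{n+1}:=T(x_n-\lambda_nf(y_n,x_n)\xi_n)$ and $\rho_{n+1}:=\max\{\rho_n,\lVert x_{n+1}\rVert\}$. $\Omega_n:=\{u\in\mathrm{Fix}(T)\mid f(y_n,u)\leq0\}$, $\Omega:=\bigcap_{n\in\mathbb{N}}\Omega_n$, and \[\Omega'_k:=\left\{u\in\mathbb{R}^N\ \middle|\ \lVert u-Tu\rVert\leq\tfrac1{k+1}\text{ and }f(y_j,u)\leq\tfrac1{k+1}\text{ for all }j\leq k\right\}.\] A nondecreasing rate of convergence for $\varepsilon_n\to0$ is a function $\tau:\mathbb{N}\to\mathbb{N}$ with $\tau(k+1)\geq\tau(k)$ and $\varepsilon_n\leq\frac1{k+1}$ for all $k\in\mathbb{N}$ and $n\geq\tau(k)$. *)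

theory Defs
  imports "HOL-Analysis.Analysis"
begin

definition firmly_nonexpansive :: "('a::real_inner \<Rightarrow> 'a) \<Rightarrow> bool" where
  "firmly_nonexpansive T \<longleftrightarrow> (\<forall>x y. (norm (T x - T y))\<^sup>2 \<le> (x - y) \<bullet> (T x - T y))"

definition Fix :: "('a \<Rightarrow> 'a) \<Rightarrow> 'a set" where
  "Fix T = {u. T u = u}"

definition EP :: "'a set \<Rightarrow> ('a \<Rightarrow> 'a \<Rightarrow> real) \<Rightarrow> 'a set" where
  "EP C f = {u \<in> C. \<forall>y\<in>C. f u y \<ge> 0}"

definition subdifferential :: "('a::real_inner \<Rightarrow> real) \<Rightarrow> 'a \<Rightarrow> 'a set" where
  "subdifferential g x = {v. \<forall>z. g z \<ge> g x + v \<bullet> (z - x)}"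

text \<open>The choices made by the algorithm are arbitrary, so it is a relation between the sequences
  and not a recursive function. For continuous \<open>\<lambda>z. f z (x n)\<close> the supremum over the
  closed ball is the maximum.\<close>

definition ep_algorithm ::
  "('a::real_inner \<Rightarrow> 'a \<Rightarrow> real) \<Rightarrow> ('a \<Rightarrow> 'a) \<Rightarrow> (nat \<Rightarrow> 'a) \<Rightarrow> (nat \<Rightarrow> real) \<Rightarrow> (nat \<Rightarrow> real) \<Rightarrow>
    (nat \<Rightarrow> real) \<Rightarrow> (nat \<Rightarrow> 'a) \<Rightarrow> (nat \<Rightarrow> 'a) \<Rightarrow> bool" where
  "ep_algorithm f T x \<rho> eps lam y \<xi> \<longleftrightarrow>
     \<rho> 0 = norm (x 0) \<and>
     (\<forall>n. eps n \<ge> 0 \<and> lam n > 0 \<and>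
          y n \<in> cball 0 (\<rho> n + 1) \<and> f (y n) (x n) \<ge> 0 \<and>
          (SUP z\<in>cball 0 (\<rho> n + 1). f z (x n)) \<le> f (y n) (x n) + eps n \<and>
          \<xi> n \<in> subdifferential (f (y n)) (x n) \<and>
          x (Suc n) = T (x n - (lam n * f (y n) (x n)) *\<^sub>R \<xi> n) \<and>
          \<rho> (Suc n) = max (\<rho> n) (norm (x (Suc n))))"

definition Omega_n :: "('a \<Rightarrow> 'a \<Rightarrow> real) \<Rightarrow> ('a \<Rightarrow> 'a) \<Rightarrow> (nat \<Rightarrow> 'a) \<Rightarrow> nat \<Rightarrow> 'a set" where
  "Omega_n f T y n = {u \<in> Fix T. f (y n) u \<le> 0}"

definition Omega :: "('a \<Rightarrow> 'a \<Rightarrow> real) \<Rightarrow> ('a \<Rightarrow> 'a) \<Rightarrow> (nat \<Rightarrow> 'a) \<Rightarrow> 'a set" where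
  "Omega f T y = (\<Inter>n. Omega_n f T y n)"

definition Omega' ::
  "('a::real_normed_vector \<Rightarrow> 'a \<Rightarrow> real) \<Rightarrow> ('a \<Rightarrow> 'a) \<Rightarrow> (nat \<Rightarrow> 'a) \<Rightarrow> nat \<Rightarrow> 'a set" where
  "Omega' f T y k =
     {u. norm (u - T u) \<le> 1 / (real k + 1) \<and> (\<forall>j\<le>k. f (y j) u \<le> 1 / (real k + 1))}"

definition nondecreasing_rate :: "(nat \<Rightarrow> real) \<Rightarrow> (nat \<Rightarrow> nat) \<Rightarrow> bool" where
  "nondecreasing_rate eps \<tau> \<longleftrightarrow>
     (\<forall>k. \<tau> (k + 1) \<ge> \<tau> k) \<and> (\<forall>k. \<forall>n\<ge>\<tau> k. eps n \<le> 1 / (real k + 1))"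

definition alpha :: "real \<Rightarrow> real \<Rightarrow> real \<Rightarrow> real" where
  "alpha a b M = - a * (M\<^sup>2 * b - 2)"

definition sigma :: "real \<Rightarrow> real \<Rightarrow> real \<Rightarrow> real \<Rightarrow> int" where
  "sigma a b M L =
     \<lceil>sqrt (2 * M * b * L) / root 4 (alpha a b M) + (M * b + 1) / sqrt (alpha a b M) + 1\<rceil>"

definition phi :: "(real \<Rightarrow> nat) \<Rightarrow> real \<Rightarrow> real" where
  "phi \<psi> \<epsilon> = 1 / (real (\<psi> \<epsilon>) + 1)"

text \<open>For \<open>c \<ge> 0\<close> and \<open>\<epsilon> > 0\<close> both ceilings are nonnegative, so \<open>nat\<close> does not truncate.\<close>

definition Phi ::
  "real \<Rightarrow> real \<Rightarrow> real \<Rightarrow> real \<Rightarrow> real \<Rightarrow> (nat \<Rightarrow> nat) \<Rightarrow> real \<Rightarrow> nat" where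
  "Phi c a b M L \<tau> \<epsilon> =
     2 * nat \<lceil>c * (real_of_int (sigma a b M L)) ^ 4 * 16 * (real_of_int \<lceil>1 / \<epsilon>\<rceil> + 1) ^ 4\<rceil>
     + max (nat \<lceil>1 / \<epsilon>\<rceil>) (\<tau> (2 * nat \<lceil>1 / \<epsilon>\<rceil> + 1)) + 1"

end

theory Submission
  imports Defs
begin

text \<open>
  The proof rests on one energy inequality. Write \<open>F n = f (y n) (x n)\<close> and let \<open>z n\<close> be the point
  reached from \<open>x n\<close> by the subgradient step, so that \<open>x (Suc n) = T (z n)\<close>. For every
  \<open>v \<in> \<Omega>\<close> the subgradient inequality (with \<open>f (y n) v \<le> 0\<close>) and firm nonexpansiveness of \<open>T\<close> give
    \<open>\<parallel>x (Suc n) - v\<parallel>\<^sup>2 + \<alpha> (F n)\<^sup>2 + \<parallel>z n - x (Suc n)\<parallel>\<^sup>2 \<le> \<parallel>x n - v\<parallel>\<^sup>2\<close>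
  (\<open>energy_decrease\<close>). Two consequences carry everything else.

  Rate. Telescoping bounds the total energy loss by \<open>c\<^sub>u\<close>, so among any \<open>m\<close> consecutive indices
  one has a loss of at most \<open>c\<^sub>u / m\<close>. If \<open>m\<close> is large this makes both \<open>F n\<close> and \<open>\<parallel>x n - T (x n)\<parallel>\<close>
  small; since \<open>y n\<close> nearly maximizes \<open>f (\<cdot>) (x n)\<close> over a ball containing all earlier \<open>y j\<close>, the
  point \<open>x n\<close> then lies in \<open>\<Omega>' k\<close> (\<open>iterate_in_Omega'\<close>). The modulus \<open>\<psi>\<close> turns this into closeness
  to \<open>\<Omega>\<close>, and since the distance to each point of \<open>\<Omega>\<close> never increases, all later iterates stay
  close to the same point. Hence the sequence is Cauchy with the stated rate
  (\<open>Fejer_limit\<close>, \<open>Fejer_convergent\<close>).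

  Limit. Convergence forces the energy loss, hence \<open>F n\<close>, to tend to \<open>0\<close>. So \<open>z n\<close> has the same
  limit \<open>l\<close> as \<open>x n\<close>, and \<open>T l = l\<close>. Near-maximality of \<open>y n\<close> yields \<open>f w l \<le> 0\<close> for all \<open>w\<close> near \<open>l\<close>;
  Minty's argument converts this dual inequality, by convexity along segments issuing from \<open>l\<close>,
  into \<open>f l w \<ge> 0\<close> for all \<open>w\<close> (\<open>local_Minty\<close>).
\<close>

section \<open>Firmly nonexpansive maps and subgradient steps\<close>

lemma firmly_nonexpansive_Pythagoras:
  fixes T :: "'a::real_inner \<Rightarrow> 'a"
  assumes "firmly_nonexpansive T" and "T v = v"
  shows "(norm (T z - v))\<^sup>2 + (norm (z - T z))\<^sup>2 \<le> (norm (z - v))\<^sup>2"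
proof -
  have "(norm (T z - v))\<^sup>2 \<le> (z - v) \<bullet> (T z - v)"
    using assms unfolding firmly_nonexpansive_def by metis
  then show ?thesis
    by (simp add: power2_norm_eq_inner inner_diff_left inner_diff_right inner_commute)
qed

lemma firmly_nonexpansive_imp_nonexpansive:
  fixes T :: "'a::real_inner \<Rightarrow> 'a"
  assumes "firmly_nonexpansive T"
  shows "norm (T z - T w) \<le> norm (z - w)"
proof (cases "T z = T w")
  case False
  have "(norm (T z - T w))\<^sup>2 \<le> (z - w) \<bullet> (T z - T w)"
    using assms unfolding firmly_nonexpansive_def by blast
  also have "\<dots> \<le> norm (z - w) * norm (T z - T w)"
    by (rule norm_cauchy_schwarz)
  finally show ?thesis
    using False by (simp add: power2_eq_square)
qed simp

lemma firmly_nonexpansive_tendsto: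
  fixes T :: "'a::real_inner \<Rightarrow> 'a"
  assumes "firmly_nonexpansive T" and "z \<longlonglongrightarrow> l"
  shows "(\<lambda>n. T (z n)) \<longlonglongrightarrow> T l"
proof -
  have "(\<lambda>n. norm (z n - l)) \<longlonglongrightarrow> 0"
    using assms(2) LIM_zero_iff tendsto_norm_zero by blast
  then have "(\<lambda>n. T (z n) - T l) \<longlonglongrightarrow> 0"
    by (rule Lim_null_comparison[rotated])
       (simp add: firmly_nonexpansive_imp_nonexpansive[OF assms(1)])
  then show ?thesis
    by (simp add: LIM_zero_iff)
qed

lemma alpha_pos:
  assumes "M > 0" and "0 < a" and "b < 2 / M\<^sup>2"
  shows "alpha a b M > 0"
proof -
  have "M\<^sup>2 * b < 2"
    using assms by (simp add: field_simps)
  then show ?thesis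
    using \<open>0 < a\<close> unfolding alpha_def by (simp add: mult_pos_neg)
qed

text \<open>A Polyak-type step of length proportional to the function value: the value at \<open>x\<close> is paid for
  by a decrease of the squared distance to any point where \<open>g\<close> is nonpositive, because the
  angle between the subgradient and \<open>x - v\<close> is controlled from below by \<open>g x\<close>.\<close>

lemma subgradient_step:
  fixes g :: "'a::real_inner \<Rightarrow> real"
  assumes sub: "\<xi> \<in> subdifferential g x" and gx: "g x \<ge> 0" and gv: "g v \<le> 0"
    and M: "norm \<xi> \<le> M" and M_pos: "M > 0"
    and a: "0 < a" and b: "b < 2 / M\<^sup>2" and t: "t \<in> {a..b}"
  shows "(norm (x - (t * g x) *\<^sub>R \<xi> - v))\<^sup>2 + alpha a b M * (g x)\<^sup>2 \<le> (norm (x - v))\<^sup>2"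
proof -
  have at: "a \<le> t" and tb: "t \<le> b"
    using t by auto
  have Mb: "M\<^sup>2 * b < 2"
    using b M_pos by (simp add: field_simps)
  have angle: "g x \<le> \<xi> \<bullet> (x - v)"
  proof -
    have "g v \<ge> g x + \<xi> \<bullet> (v - x)"
      using sub unfolding subdifferential_def by blast
    then show ?thesis
      using gv by (simp add: inner_diff_right)
  qed
  have "(norm (x - (t * g x) *\<^sub>R \<xi> - v))\<^sup>2
      = (norm (x - v))\<^sup>2 - 2 * (t * g x) * (\<xi> \<bullet> (x - v)) + (t * g x)\<^sup>2 * (norm \<xi>)\<^sup>2"
  proof -
    have "(norm (d - s *\<^sub>R \<xi>))\<^sup>2 = (norm d)\<^sup>2 - 2 * s * (\<xi> \<bullet> d) + s\<^sup>2 * (norm \<xi>)\<^sup>2" for d s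
      by (simp only: power2_norm_eq_inner inner_diff_left inner_diff_right inner_scaleR_left
          inner_scaleR_right inner_commute[of d \<xi>]) (simp add: power2_eq_square algebra_simps)
    from this[of "x - v" "t * g x"] show ?thesis
      by (simp add: algebra_simps)
  qed
  also have "\<dots> \<le> (norm (x - v))\<^sup>2 - 2 * (t * g x) * g x + (t * g x)\<^sup>2 * M\<^sup>2"
  proof -
    have "2 * (t * g x) * g x \<le> 2 * (t * g x) * (\<xi> \<bullet> (x - v))"
      using angle a at gx by (intro mult_left_mono) auto
    moreover have "(t * g x)\<^sup>2 * (norm \<xi>)\<^sup>2 \<le> (t * g x)\<^sup>2 * M\<^sup>2"
      using M by (intro mult_left_mono power_mono) auto
    ultimately show ?thesis by linarith
  qed
  also have "\<dots> = (norm (x - v))\<^sup>2 - t * (2 - M\<^sup>2 * t) * (g x)\<^sup>2"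
    by (simp add: power2_eq_square algebra_simps)
  also have "\<dots> \<le> (norm (x - v))\<^sup>2 - alpha a b M * (g x)\<^sup>2"
  proof -
    have "M\<^sup>2 * t \<le> M\<^sup>2 * b"
      using tb by (intro mult_left_mono) auto
    then have "a * (2 - M\<^sup>2 * b) \<le> t * (2 - M\<^sup>2 * t)"
      using a at Mb by (intro mult_mono) auto
    then have "alpha a b M \<le> t * (2 - M\<^sup>2 * t)"
      unfolding alpha_def by (simp add: algebra_simps)
    then show ?thesis
      by (simp add: mult_right_mono)
  qed
  finally show ?thesis by linarith
qed

section \<open>Fejer monotone sequences\<close>

text \<open>If one iterate is within \<open>\<epsilon>\<close> of \<open>S\<close>, then it is within \<open>\<epsilon>\<close> of one particular point of \<open>S\<close>, and
  monotonicity keeps the whole tail in the ball of radius \<open>\<epsilon>\<close> around that point.\<close>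

lemma Fejer_tail:
  fixes x :: "nat \<Rightarrow> 'a::real_normed_vector"
  assumes fejer: "\<And>n v. v \<in> S \<Longrightarrow> norm (x (Suc n) - v) \<le> norm (x n - v)"
    and "S \<noteq> {}" and "infdist (x N) S < \<epsilon>"
  obtains v where "v \<in> S" and "\<And>n. n \<ge> N \<Longrightarrow> norm (x n - v) < \<epsilon>"
proof -
  obtain v where v: "v \<in> S" "dist (x N) v < \<epsilon>"
    using assms(2,3) by (auto simp: infdist_notempty cINF_less_iff)
  have "norm (x n - v) \<le> norm (x N - v)" if "n \<ge> N" for n
    using lift_Suc_antimono_le[of "\<lambda>n. norm (x n - v)", OF fejer[OF v(1)] that] .
  then show ?thesis
    using that v by (metis dist_norm le_less_trans)
qed

lemma Fejer_convergent:
  fixes x :: "nat \<Rightarrow> 'a::banach"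
  assumes fejer: "\<And>n v. v \<in> S \<Longrightarrow> norm (x (Suc n) - v) \<le> norm (x n - v)"
    and "S \<noteq> {}" and close: "\<And>\<epsilon>. \<epsilon> > 0 \<Longrightarrow> \<exists>N. infdist (x N) S < \<epsilon>"
  shows "convergent x"
proof -
  have "\<exists>N. \<forall>m\<ge>N. \<forall>n\<ge>N. norm (x m - x n) < e" if e: "e > 0" for e
  proof -
    obtain N where "infdist (x N) S < e / 2"
      using close e half_gt_zero by blast
    then obtain v where v: "\<And>n. n \<ge> N \<Longrightarrow> norm (x n - v) < e / 2"
      using Fejer_tail[where x = x, OF fejer \<open>S \<noteq> {}\<close>] by blast
    have "norm (x m - x n) < e" if "m \<ge> N" "n \<ge> N" for m n
      using norm_triangle_ineq4[of "x m - v" "x n - v"] v[OF that(1)] v[OF that(2)] by simp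
    then show ?thesis by blast
  qed
  then show ?thesis
    by (simp add: CauchyI Cauchy_convergent)
qed

lemma Fejer_limit:
  fixes x :: "nat \<Rightarrow> 'a::real_normed_vector"
  assumes fejer: "\<And>n v. v \<in> S \<Longrightarrow> norm (x (Suc n) - v) \<le> norm (x n - v)"
    and "S \<noteq> {}" and "infdist (x N) S < \<epsilon>" and lim: "x \<longlonglongrightarrow> l" and "n \<ge> N"
  shows "norm (x n - l) < 2 * \<epsilon>"
proof -
  obtain v where v: "\<And>n. n \<ge> N \<Longrightarrow> norm (x n - v) < \<epsilon>"
    using Fejer_tail[where x = x, OF fejer assms(2,3)] by blast
  have "norm (l - v) \<le> \<epsilon>"
    using v by (intro LIMSEQ_le_const2[OF tendsto_norm[OF tendsto_diff[OF lim tendsto_const]]])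
       (auto intro: less_imp_le)
  then show ?thesis
    using v[OF \<open>n \<ge> N\<close>] norm_triangle_ineq4[of "x n - v" "l - v"] by simp
qed

section \<open>Minty's argument\<close>

text \<open>On the segment from \<open>l\<close> to \<open>w\<close>, convexity gives
  \<open>0 = f z z \<le> (1 - t) * f z l + t * f z w\<close> at \<open>z = l + t *\<^sub>R (w - l)\<close>. Where \<open>f z l \<le> 0\<close> this forces
  \<open>f z w \<ge> 0\<close>, and \<open>t\<close> can then be sent to \<open>0\<close>; so the dual inequality is only needed near \<open>l\<close>.\<close>

lemma local_Minty:
  fixes f :: "'a::real_normed_vector \<Rightarrow> 'a \<Rightarrow> real"
  assumes diag: "\<And>z. f z z = 0"
    and cont: "continuous_on UNIV (\<lambda>z. f z w)"
    and convex: "\<And>z. convex_on UNIV (f z)"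
    and dual: "\<forall>\<^sub>F z in nhds l. f z l \<le> 0"
  shows "f l w \<ge> 0"
proof -
  define z where "z t = l + t *\<^sub>R (w - l)" for t :: real
  have "(z \<longlongrightarrow> l + 0 *\<^sub>R (w - l)) (at_right 0)"
    unfolding z_def by (intro tendsto_intros)
  then have z: "(z \<longlongrightarrow> l) (at_right 0)"
    by simp
  have "\<forall>\<^sub>F t in at_right 0. f (z t) l \<le> 0"
    using dual z by (rule eventually_compose_filterlim)
  moreover have "\<forall>\<^sub>F t in at_right (0::real). t \<in> {0<..<1}"
    by (rule eventually_at_right_real) simp
  ultimately have "\<forall>\<^sub>F t in at_right 0. 0 \<le> f (z t) w"
  proof eventually_elim
    case (elim t)
    have "f (z t) ((1 - t) *\<^sub>R l + t *\<^sub>R w) \<le> (1 - t) * f (z t) l + t * f (z t) w"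
      using elim by (intro convex_onD[OF convex]) auto
    moreover have "(1 - t) *\<^sub>R l + t *\<^sub>R w = z t"
      by (simp add: z_def algebra_simps)
    moreover have "(1 - t) * f (z t) l \<le> 0"
      using elim by (intro mult_nonneg_nonpos) auto
    ultimately have "0 \<le> t * f (z t) w"
      using diag[of "z t"] by simp
    then show ?case
      using elim by (simp add: zero_le_mult_iff)
  qed
  moreover have "((\<lambda>t. f (z t) w) \<longlongrightarrow> f l w) (at_right 0)"
    using cont z by (rule continuous_on_tendsto_compose) auto
  ultimately show ?thesis
    by (intro tendsto_lowerbound) auto
qed

section \<open>The iteration\<close>

locale ep_iteration =
  fixes f :: "'a::euclidean_space \<Rightarrow> 'a \<Rightarrow> real" and T :: "'a \<Rightarrow> 'a"
    and x y \<xi> :: "nat \<Rightarrow> 'a" and \<rho> eps lam :: "nat \<Rightarrow> real" and M a b :: real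
  assumes f_diag: "\<And>z. f z z = 0"
    and f_cont: "\<And>w. continuous_on UNIV (\<lambda>z. f z w)"
    and f_convex: "\<And>z. convex_on UNIV (f z)"
    and T_firm: "firmly_nonexpansive T"
    and algorithm: "ep_algorithm f T x \<rho> eps lam y \<xi>"
    and Omega_nonempty: "Omega f T y \<noteq> {}"
    and M_pos: "M > 0"
    and M_bound: "\<And>n. norm (\<xi> n) \<le> M"
    and a_pos: "0 < a" and b_less: "b < 2 / M\<^sup>2"
    and lam: "\<And>n. lam n \<in> {a..b}"
begin

definition val :: "nat \<Rightarrow> real" where
  "val n = f (y n) (x n)"

definition step :: "nat \<Rightarrow> 'a" where
  "step n = x n - (lam n * val n) *\<^sub>R \<xi> n"

lemma x_Suc: "x (Suc n) = T (step n)"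
  and val_nonneg: "val n \<ge> 0"
  and subgradient: "\<xi> n \<in> subdifferential (f (y n)) (x n)"
  and y_in_ball: "y n \<in> cball 0 (\<rho> n + 1)"
  and near_max: "(SUP z\<in>cball 0 (\<rho> n + 1). f z (x n)) \<le> val n + eps n"
  and rho_0: "\<rho> 0 = norm (x 0)"
  and rho_Suc: "\<rho> (Suc n) = max (\<rho> n) (norm (x (Suc n)))"
  using algorithm unfolding ep_algorithm_def val_def step_def by blast+

lemma step_bounds: "0 < b" "lam n > 0" "lam n \<le> b"
  using lam[of n] a_pos by auto

lemma alpha_positive: "alpha a b M > 0"
  by (rule alpha_pos[OF M_pos a_pos b_less])

lemma rho_mono: "j \<le> n \<Longrightarrow> \<rho> j \<le> \<rho> n"
  by (rule lift_Suc_mono_le) (auto simp: rho_Suc)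

lemma norm_x_le_rho: "norm (x n) \<le> \<rho> n"
  by (cases n) (auto simp: rho_0 rho_Suc)

lemma f_le_val:
  assumes "z \<in> cball 0 (\<rho> n + 1)"
  shows "f z (x n) \<le> val n + eps n"
proof -
  have "compact ((\<lambda>z. f z (x n)) ` cball 0 (\<rho> n + 1))"
    by (intro compact_continuous_image continuous_on_subset[OF f_cont]) auto
  then have "bdd_above ((\<lambda>z. f z (x n)) ` cball 0 (\<rho> n + 1))"
    by (simp add: bounded_imp_bdd_above compact_imp_bounded)
  then have "f z (x n) \<le> (SUP z\<in>cball 0 (\<rho> n + 1). f z (x n))"
    using assms by (rule cSUP_upper2[rotated 2, OF order_refl])
  then show ?thesis
    using near_max[of n] by linarith
qed

lemma energy_decrease:
  assumes "v \<in> Omega f T y"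
  shows "(norm (x (Suc n) - v))\<^sup>2 + (alpha a b M * (val n)\<^sup>2 + (norm (step n - x (Suc n)))\<^sup>2)
    \<le> (norm (x n - v))\<^sup>2"
proof -
  have v: "T v = v" "f (y n) v \<le> 0"
    using assms unfolding Omega_def Omega_n_def Fix_def by auto
  have "(norm (step n - v))\<^sup>2 + alpha a b M * (val n)\<^sup>2 \<le> (norm (x n - v))\<^sup>2"
    using subgradient_step[OF subgradient _ v(2) M_bound M_pos a_pos b_less lam] val_nonneg[of n]
    unfolding step_def val_def by blast
  then show ?thesis
    using firmly_nonexpansive_Pythagoras[OF T_firm v(1), of "step n"] by (simp add: x_Suc)
qed

lemma Fejer:
  assumes "v \<in> Omega f T y"
  shows "norm (x (Suc n) - v) \<le> norm (x n - v)"
proof -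
  have "alpha a b M * (val n)\<^sup>2 \<ge> 0"
    using alpha_positive by simp
  then have "(norm (x (Suc n) - v))\<^sup>2 \<le> (norm (x n - v))\<^sup>2"
    using energy_decrease[OF assms, of n] zero_le_power2[of "norm (step n - x (Suc n))"]
    by linarith
  then show ?thesis
    by (simp add: power2_le_iff_abs_le)
qed

lemma dist_le_initial:
  assumes "v \<in> Omega f T y"
  shows "norm (x n - v) \<le> norm (x 0 - v)"
  by (rule lift_Suc_antimono_le[of "\<lambda>n. norm (x n - v)"]) (simp_all add: Fejer[OF assms])

lemma bounded_iterates: "bounded (range x)"
proof -
  obtain v where "v \<in> Omega f T y"
    using Omega_nonempty by blast
  then have "range x \<subseteq> cball v (norm (x 0 - v))"
    using dist_le_initial by (auto simp: dist_norm norm_minus_commute)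
  then show ?thesis
    using bounded_cball bounded_subset by blast
qed

lemma step_displacement: "norm (step n - x n) \<le> b * M * val n"
proof -
  have "norm (step n - x n) = lam n * val n * norm (\<xi> n)"
    using step_bounds(2)[of n] val_nonneg[of n] by (simp add: step_def abs_mult)
  also have "\<dots> \<le> b * val n * M"
    using step_bounds(1) step_bounds(2,3)[of n] val_nonneg[of n] M_bound[of n]
    by (intro mult_mono mult_nonneg_nonneg) auto
  finally show ?thesis
    by (simp add: mult_ac)
qed

lemma fixed_point_residual:
  "norm (x n - T (x n)) \<le> 2 * (b * M * val n) + norm (step n - x (Suc n))"
proof -
  have "norm (x n - T (x n))
      \<le> norm (x n - step n) + norm (step n - x (Suc n)) + norm (x (Suc n) - T (x n))"
    using norm_triangle_ineq[of "x n - step n + (step n - x (Suc n))" "x (Suc n) - T (x n)"]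
      norm_triangle_ineq[of "x n - step n" "step n - x (Suc n)"] by simp
  moreover have "norm (x (Suc n) - T (x n)) \<le> norm (step n - x n)"
    unfolding x_Suc by (rule firmly_nonexpansive_imp_nonexpansive[OF T_firm])
  ultimately show ?thesis
    using step_displacement[of n] norm_minus_commute[of "x n" "step n"] by linarith
qed

lemma small_energy_loss:
  assumes v: "v \<in> Omega f T y" and "m > 0"
  shows "\<exists>n\<ge>N. n < N + m \<and> real m * (alpha a b M * (val n)\<^sup>2 + (norm (step n - x (Suc n)))\<^sup>2)
    \<le> (norm (x 0 - v))\<^sup>2"
proof (rule ccontr)
  define loss where "loss n = alpha a b M * (val n)\<^sup>2 + (norm (step n - x (Suc n)))\<^sup>2" for n
  assume "\<not> ?thesis"
  then have large: "(norm (x 0 - v))\<^sup>2 / m < loss n" if "n \<in> {N..<N + m}" for n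
    using that \<open>m > 0\<close> unfolding loss_def by (force simp: divide_less_eq mult.commute not_le)
  have "(norm (x 0 - v))\<^sup>2 = (\<Sum>n\<in>{N..<N + m}. (norm (x 0 - v))\<^sup>2 / m)"
    using \<open>m > 0\<close> by simp
  also have "\<dots> < sum loss {N..<N + m}"
    using large \<open>m > 0\<close> by (intro sum_strict_mono) auto
  also have "\<dots> \<le> (\<Sum>n\<in>{N..<N + m}. (norm (x n - v))\<^sup>2 - (norm (x (Suc n) - v))\<^sup>2)"
    unfolding loss_def using energy_decrease[OF v] by (intro sum_mono) (simp add: le_diff_eq add.commute)
  also have "\<dots> = (norm (x N - v))\<^sup>2 - (norm (x (N + m) - v))\<^sup>2"
    using sum_Suc_diff'[of N "N + m" "\<lambda>n. - (norm (x n - v))\<^sup>2"] by simp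
  also have "\<dots> \<le> (norm (x N - v))\<^sup>2"
    by simp
  also have "\<dots> \<le> (norm (x 0 - v))\<^sup>2"
    using dist_le_initial[OF v] by (intro power_mono) auto
  finally show False by simp
qed

text \<open>An energy loss of at most \<open>r\<^sup>2\<close> bounds \<open>val n\<close> by \<open>r / sqrt \<alpha>\<close>, and the fixed point residual contains
  \<open>val n\<close> with a factor \<open>M * b\<close>. The summand \<open>(M * b + 1) / sqrt \<alpha>\<close> of \<open>sigma\<close> absorbs both, so
  that \<open>(M * b + 1) * val n\<close> is at most \<open>\<sigma> * r\<close>.\<close>

lemma sigma_lower_bounds:
  assumes "L \<ge> 0"
  shows "1 \<le> real_of_int (sigma a b M L)"
    and "M * b + 1 \<le> real_of_int (sigma a b M L) * sqrt (alpha a b M)"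
proof -
  define s where "s = sqrt (alpha a b M)"
  have s: "s > 0"
    using alpha_positive by (simp add: s_def)
  have "sqrt (2 * M * b * L) / root 4 (alpha a b M) \<ge> 0"
    using assms M_pos step_bounds(1) alpha_positive by simp
  then have lower: "(M * b + 1) / s + 1 \<le> real_of_int (sigma a b M L)"
    unfolding sigma_def s_def by linarith
  moreover have "(M * b + 1) / s \<ge> 0"
    using s M_pos step_bounds(1) by simp
  ultimately show "1 \<le> real_of_int (sigma a b M L)"
    by linarith
  have "(M * b + 1) / s \<le> real_of_int (sigma a b M L)"
    using lower by linarith
  then show "M * b + 1 \<le> real_of_int (sigma a b M L) * sqrt (alpha a b M)"
    using s by (simp add: divide_le_eq s_def)
qed

text \<open>The window of \<open>2 * P + 1\<close> indices is long enough for one of them to have an energy loss of at most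
  \<open>r\<^sup>2\<close> with \<open>r = 1 / (4 * \<sigma>\<^sup>2 * (k + 2)\<^sup>2)\<close>. It starts late enough that \<open>eps n\<close> is small and that
  \<open>y 0, \<dots>, y k\<close> all belong to the ball over which \<open>y n\<close> is nearly optimal.\<close>

lemma iterate_in_Omega':
  assumes v: "v \<in> Omega f T y" and c: "(norm (x 0 - v))\<^sup>2 \<le> c" and L: "L \<ge> 0"
    and rate: "nondecreasing_rate eps \<tau>"
  shows "\<exists>n\<le>Phi c a b M L \<tau> (1 / (real k + 1)). x n \<in> Omega' f T y k"
proof -
  define \<sigma> where "\<sigma> = real_of_int (sigma a b M L)"
  define q where "q = real k + 2"
  define P where "P = nat \<lceil>c * \<sigma> ^ 4 * 16 * q ^ 4\<rceil>"
  define N where "N = max (k + 1) (\<tau> (2 * (k + 1) + 1))"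
  define r where "r = 1 / (4 * \<sigma>\<^sup>2 * q\<^sup>2)"
  have \<sigma>: "\<sigma> \<ge> 1" "M * b + 1 \<le> \<sigma> * sqrt (alpha a b M)"
    using sigma_lower_bounds[OF L] by (simp_all add: \<sigma>_def)
  have q: "q \<ge> 2" "q > 0"
    by (simp_all add: q_def)
  have r: "r > 0"
    using \<sigma> q by (simp add: r_def)
  have "\<lceil>real k + 1\<rceil> = int k + 1"
    by linarith
  then have Phi: "Phi c a b M L \<tau> (1 / (real k + 1)) = 2 * P + N + 1"
    unfolding Phi_def P_def N_def \<sigma>_def q_def by (simp add: nat_add_distrib add.commute)
  obtain n where n: "n \<ge> N" "n < N + (2 * P + 1)"
    and loss: "real (2 * P + 1) * (alpha a b M * (val n)\<^sup>2 + (norm (step n - x (Suc n)))\<^sup>2)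
      \<le> (norm (x 0 - v))\<^sup>2"
    using small_energy_loss[OF v, of "2 * P + 1" N] by auto
  have loss_r: "alpha a b M * (val n)\<^sup>2 + (norm (step n - x (Suc n)))\<^sup>2 \<le> r\<^sup>2"
  proof -
    have "c * \<sigma> ^ 4 * 16 * q ^ 4 \<le> real P"
      unfolding P_def by linarith
    then have "c / r\<^sup>2 \<le> real P"
      by (simp add: r_def power_divide power_mult_distrib power_mult[symmetric] mult_ac)
    then have "c \<le> real P * r\<^sup>2"
      using r by (simp add: divide_le_eq)
    also have "\<dots> \<le> real (2 * P + 1) * r\<^sup>2"
      by (intro mult_right_mono) auto
    finally have "real (2 * P + 1) * (alpha a b M * (val n)\<^sup>2 + (norm (step n - x (Suc n)))\<^sup>2)
        \<le> real (2 * P + 1) * r\<^sup>2"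
      using loss c by linarith
    then show ?thesis
      by (rule mult_left_le_imp_le) simp
  qed
  have d: "norm (step n - x (Suc n)) \<le> r"
  proof (rule power2_le_imp_le)
    show "(norm (step n - x (Suc n)))\<^sup>2 \<le> r\<^sup>2"
      using loss_r alpha_positive
      by (smt (verit) mult_nonneg_nonneg zero_le_power2)
  qed (use r in simp)
  have val: "(M * b + 1) * val n \<le> \<sigma> * r"
  proof -
    have "sqrt (alpha a b M) * val n \<le> r"
    proof (rule power2_le_imp_le)
      show "(sqrt (alpha a b M) * val n)\<^sup>2 \<le> r\<^sup>2"
      proof -
        have "(sqrt (alpha a b M) * val n)\<^sup>2 = alpha a b M * (val n)\<^sup>2"
          using alpha_positive by (simp add: power_mult_distrib)
        then show ?thesis
          using loss_r zero_le_power2[of "norm (step n - x (Suc n))"] by linarith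
      qed
    qed (use r in simp)
    then have "\<sigma> * (sqrt (alpha a b M) * val n) \<le> \<sigma> * r"
      using \<sigma>(1) by (intro mult_left_mono) auto
    moreover have "(M * b + 1) * val n \<le> \<sigma> * sqrt (alpha a b M) * val n"
      using \<sigma>(2) val_nonneg by (intro mult_right_mono) auto
    ultimately show ?thesis
      by (simp add: mult.assoc)
  qed
  have Mb: "M * b * val n \<ge> 0"
    using M_pos step_bounds(1) val_nonneg by simp
  have r_small: "\<sigma> * r \<le> 1 / (4 * q\<^sup>2)" "r \<le> 1 / (4 * q\<^sup>2)"
  proof -
    have "\<sigma> * r = 1 / (4 * \<sigma> * q\<^sup>2)"
      using \<sigma>(1) by (simp add: r_def power2_eq_square)
    also have "\<dots> \<le> 1 / (4 * q\<^sup>2)"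
      using \<sigma>(1) q by (intro divide_left_mono) auto
    finally show *: "\<sigma> * r \<le> 1 / (4 * q\<^sup>2)" .
    have "1 * r \<le> \<sigma> * r"
      using \<sigma>(1) r by (intro mult_right_mono) auto
    then show "r \<le> 1 / (4 * q\<^sup>2)"
      using * by linarith
  qed
  have q_square: "1 / (4 * q\<^sup>2) \<le> 1 / (8 * (real k + 1))"
  proof -
    have "8 * (real k + 1) \<le> 4 * q\<^sup>2"
      by (simp add: q_def power2_eq_square algebra_simps)
    then show ?thesis
      using q by (intro divide_left_mono) auto
  qed
  have residual: "norm (x n - T (x n)) \<le> 1 / (real k + 1)"
  proof -
    have "norm (x n - T (x n)) \<le> 2 * (M * b * val n) + norm (step n - x (Suc n))"
      using fixed_point_residual[of n] by (simp add: mult_ac)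
    also have "\<dots> \<le> 3 * (1 / (8 * (real k + 1)))"
      using val val_nonneg[of n] d r_small q_square by (simp only: distrib_right)
    also have "\<dots> \<le> 1 / (real k + 1)"
      by (simp add: field_simps)
    finally show ?thesis .
  qed
  have "val n \<le> 1 / (8 * (real k + 1))"
    using val Mb r_small q_square by (simp only: distrib_right)
  moreover have "eps n \<le> 1 / (2 * (real k + 1))"
  proof -
    have "eps n \<le> 1 / (real (2 * (k + 1) + 1) + 1)"
      using rate n(1) unfolding nondecreasing_rate_def N_def by (meson max.boundedE)
    also have "\<dots> \<le> 1 / (2 * (real k + 1))"
      by (intro divide_left_mono) auto
    finally show ?thesis .
  qed
  moreover have "1 / (8 * t) + 1 / (2 * t) \<le> 1 / t" if "t > 0" for t :: real
    using that by (simp add: field_simps)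
  from this[of "real k + 1"] have "1 / (8 * (real k + 1)) + 1 / (2 * (real k + 1)) \<le> 1 / (real k + 1)"
    by simp
  ultimately have total: "val n + eps n \<le> 1 / (real k + 1)"
    by linarith
  have "f (y j) (x n) \<le> 1 / (real k + 1)" if "j \<le> k" for j
  proof -
    have "\<rho> j \<le> \<rho> n"
      using that n(1) by (intro rho_mono) (simp add: N_def)
    then have "y j \<in> cball 0 (\<rho> n + 1)"
      using y_in_ball[of j] by simp
    then show ?thesis
      using f_le_val total by (meson order_trans)
  qed
  with residual have "x n \<in> Omega' f T y k"
    unfolding Omega'_def by blast
  moreover have "n \<le> Phi c a b M L \<tau> (1 / (real k + 1))"
    using n(2) by (simp add: Phi)
  ultimately show ?thesis by blast
qed

lemma limit_in_EP:
  assumes lim: "x \<longlonglongrightarrow> l" and eps: "eps \<longlonglongrightarrow> 0"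
  shows "l \<in> EP (Fix T) f"
proof -
  obtain v where v: "v \<in> Omega f T y"
    using Omega_nonempty by blast
  have val: "val \<longlonglongrightarrow> 0"
  proof -
    define d where
      "d n = ((norm (x n - v))\<^sup>2 - (norm (x (Suc n) - v))\<^sup>2) / alpha a b M" for n
    have "d \<longlonglongrightarrow> ((norm (l - v))\<^sup>2 - (norm (l - v))\<^sup>2) / alpha a b M"
      unfolding d_def using alpha_positive by (intro tendsto_intros lim LIMSEQ_Suc) auto
    then have d: "d \<longlonglongrightarrow> 0"
      by simp
    have "(val n)\<^sup>2 \<le> d n" for n
    proof -
      have "alpha a b M * (val n)\<^sup>2 \<le> (norm (x n - v))\<^sup>2 - (norm (x (Suc n) - v))\<^sup>2"
        using energy_decrease[OF v, of n] zero_le_power2[of "norm (step n - x (Suc n))"]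
        by linarith
      then show ?thesis
        unfolding d_def using alpha_positive by (simp add: pos_le_divide_eq mult.commute)
    qed
    then have "\<forall>\<^sub>F n in sequentially. norm ((val n)\<^sup>2) \<le> d n"
      by simp
    then have "(\<lambda>n. (val n)\<^sup>2) \<longlonglongrightarrow> 0"
      using d by (rule Lim_null_comparison)
    then have "(\<lambda>n. sqrt ((val n)\<^sup>2)) \<longlonglongrightarrow> sqrt 0"
      by (rule tendsto_real_sqrt)
    then show ?thesis
      by (simp add: val_nonneg)
  qed
  have "(\<lambda>n. step n - x n) \<longlonglongrightarrow> 0"
  proof (rule Lim_null_comparison)
    show "(\<lambda>n. b * M * val n) \<longlonglongrightarrow> 0"
      using val by (rule tendsto_mult_right_zero)
  qed (simp add: step_displacement)
  then have "step \<longlonglongrightarrow> l"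
    using tendsto_add[OF _ lim] by fastforce
  then have "(\<lambda>n. x (Suc n)) \<longlonglongrightarrow> T l"
    unfolding x_Suc by (rule firmly_nonexpansive_tendsto[OF T_firm])
  then have fixed: "T l = l"
    using LIMSEQ_Suc[OF lim] LIMSEQ_unique by blast
  \<comment> \<open>The search balls exceed \<open>norm (x n)\<close> by \<open>1\<close>, so they eventually cover a neighbourhood of \<open>l\<close>.\<close>
  have dual: "f w l \<le> 0" if w: "norm w < norm l + 1" for w
  proof -
    have "(\<lambda>n. norm (x n) + 1) \<longlonglongrightarrow> norm l + 1"
      by (intro tendsto_intros lim)
    then have "\<forall>\<^sub>F n in sequentially. norm w < norm (x n) + 1"
      using w by (rule order_tendstoD)
    then have upper: "\<forall>\<^sub>F n in sequentially. f w (x n) \<le> val n + eps n"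
    proof eventually_elim
      case (elim n)
      then have "w \<in> cball 0 (\<rho> n + 1)"
        using norm_x_le_rho[of n] by simp
      then show ?case by (rule f_le_val)
    qed
    have "continuous_on UNIV (f w)"
      using f_convex by (intro convex_on_continuous) auto
    then have "(\<lambda>n. f w (x n)) \<longlonglongrightarrow> f w l"
      using lim by (rule continuous_on_tendsto_compose) auto
    moreover have "(\<lambda>n. val n + eps n) \<longlonglongrightarrow> 0"
      using tendsto_add[OF val eps] by simp
    ultimately show ?thesis
      using upper by (intro tendsto_le[of sequentially]) auto
  qed
  have "\<forall>\<^sub>F w in nhds l. norm w < norm l + 1"
    by (intro order_tendstoD(2)[of norm "norm l"] tendsto_norm filterlim_ident) simp
  then have "\<forall>\<^sub>F w in nhds l. f w l \<le> 0"
    by eventually_elim (rule dual)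
  then have "f l w \<ge> 0" for w
    by (rule local_Minty[OF f_diag f_cont f_convex])
  then show ?thesis
    using fixed by (simp add: EP_def Fix_def)
qed

end

section \<open>Convergence with a rate\<close>

theorem theorem31:
  fixes f :: "real ^ 'n \<Rightarrow> real ^ 'n \<Rightarrow> real"
    and T :: "real ^ 'n \<Rightarrow> real ^ 'n"
    and x y \<xi> :: "nat \<Rightarrow> real ^ 'n"
    and \<rho> eps lam :: "nat \<Rightarrow> real"
    and u :: "real ^ 'n"
    and c\<^sub>u M a b L :: real
    and \<tau> :: "nat \<Rightarrow> nat"
    and \<psi> :: "real \<Rightarrow> nat"
  assumes f_diag: "\<And>z. f z z = 0"
    and f_cont: "\<And>w. continuous_on UNIV (\<lambda>z. f z w)"
    and f_convex: "\<And>z. convex_on UNIV (f z)"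
    and T_firm: "firmly_nonexpansive T"
    and Fix_nonempty: "Fix T \<noteq> {}"
    and algorithm: "ep_algorithm f T x \<rho> eps lam y \<xi>"
    and u: "u \<in> Omega f T y"
    and c\<^sub>u: "c\<^sub>u \<ge> (norm (x 0 - u))\<^sup>2"
    and M_pos: "M > 0"
    and M_bound: "\<And>n. M \<ge> norm (\<xi> n)"
    and interval: "{a..b} \<subseteq> {0<..<2 / M\<^sup>2}"
    and lam: "\<And>n. lam n \<in> {a..b}"
    and L: "L \<ge> diameter (range x)"
    and eps_nonneg: "\<And>n. eps n \<ge> 0"
    and eps_lim: "eps \<longlonglongrightarrow> 0"
    and eps_rate: "nondecreasing_rate eps \<tau>"
    and \<psi>: "\<forall>\<epsilon>>0. \<forall>z\<in>cball u (sqrt c\<^sub>u).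
               z \<in> Omega' f T y (\<psi> \<epsilon>) \<longrightarrow> infdist z (Omega f T y) < \<epsilon>"
  shows "convergent x \<and> lim x \<in> EP (Fix T) f \<and>
         (\<forall>k. \<forall>n\<ge>Phi c\<^sub>u a b M L \<tau> (phi \<psi> (1 / (2 * (real k + 1)))).
             norm (x n - lim x) < 1 / (real k + 1))"
proof -
  have "a \<le> b"
    using lam[of 0] by simp
  then have "0 < a" and "b < 2 / M\<^sup>2"
    using interval by (auto simp: subset_iff)
  then interpret ep_iteration f T x y \<xi> \<rho> eps lam M a b
    using f_diag f_cont f_convex T_firm algorithm u M_pos M_bound lam
    by unfold_locales auto
  have L_nonneg: "L \<ge> 0"
    using L diameter_ge_0[OF bounded_iterates] by linarith
  have close: "\<exists>n\<le>Phi c\<^sub>u a b M L \<tau> (phi \<psi> \<epsilon>). infdist (x n) (Omega f T y) < \<epsilon>" if "\<epsilon> > 0" for \<epsilon>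
  proof -
    obtain n where n: "n \<le> Phi c\<^sub>u a b M L \<tau> (phi \<psi> \<epsilon>)" "x n \<in> Omega' f T y (\<psi> \<epsilon>)"
      using iterate_in_Omega'[OF u c\<^sub>u L_nonneg eps_rate] unfolding phi_def by blast
    have "norm (x n - u) \<le> sqrt c\<^sub>u"
      using dist_le_initial[OF u] c\<^sub>u by (meson order_trans real_le_rsqrt)
    then have "x n \<in> cball u (sqrt c\<^sub>u)"
      by (simp add: dist_norm norm_minus_commute)
    then show ?thesis
      using \<psi> n that by blast
  qed
  have "convergent x"
    using close
    by (intro Fejer_convergent[where S = "Omega f T y"]) (auto simp: Fejer Omega_nonempty)
  then have lim: "x \<longlonglongrightarrow> lim x"
    by (simp add: convergent_LIMSEQ_iff)
  have "norm (x n - lim x) < 1 / (real k + 1)"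
    if n: "n \<ge> Phi c\<^sub>u a b M L \<tau> (phi \<psi> (1 / (2 * (real k + 1))))" for k n
  proof -
    have "1 / (2 * (real k + 1)) > 0"
      by simp
    from close[OF this] obtain m
      where "m \<le> n" and "infdist (x m) (Omega f T y) < 1 / (2 * (real k + 1))"
      using n by (meson order_trans)
    then have "norm (x n - lim x) < 2 * (1 / (2 * (real k + 1)))"
      using Fejer_limit[where x = x, OF Fejer Omega_nonempty _ lim] by blast
    then show ?thesis
      by (simp only: mult_divide_mult_cancel_left times_divide_eq_right)
  qed
  then show ?thesis
    using \<open>convergent x\<close> limit_in_EP[OF lim eps_lim] by blast
qed

end
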